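(* Let $\mathcal P$ be a set-graded non-commutative Poisson algebra, with support $\Lambda_{\mathcal S}$ and a fixed choice of distinguished element $0$ (possibly $0=\emptyset$), which is centerless ($Z(\mathcal P)=0$), $\Lambda_{\mathcal S}$-multiplicative, of maximal length, and with $\mathcal P_0$ tight. Then $\mathcal P$ is gr-simple if and only if all elements of $\Lambda_{\mathcal S}\setminus\{0\}$ are connected to each other (that is, $\lambda\sim\mu$ for all $\lambda,\mu\in\Lambda_{\mathcal S}\setminus\{0\}$).
   Context: Base field $\mathbb F$ of characteristic zero; arbitrary dimension. A non-commutative Poisson algebra is a Lie algebra $(\mathcal P,[\cdot,\cdot])$ over $\mathbb F$ endowed with an associative (not necessarily commutative) bilinear product, written by juxtaposition, such that $[x,yz]=[x,y]z+y[x,z]$ for all $x,y,z\in\mathcal P$. For subspaces $A,B$, $[A,B]$ and $AB$ denote the linear spans of all $[a,b]$, resp. $ab$. $\mathcal P$ is set-graded by a non-empty set $\mathcal S$ if $\mathcal P=\bigoplus_{s\in\mathcal S}\mathcal P_s$ is a direct sum of non-zero subspaces such that for any $s,t\in\mathcal S$ with $[\mathcal P_s,\mathcal P_t]+\mathcal P_s\mathcal P_t\neq0$ there is a unique $u\in\mathcal S$ with $[\mathcal P_s,\mathcal P_t]+\mathcal P_s\mathcal P_t\subset\mathcal P_u$. The support is $\Lambda_{\mathcal S}=\{\lambda\in\mathcal S:\mathcal P_\lambda\neq0\}$. A graded ideal is a subspace $I=\bigoplus_s (I\cap\mathcal P_s)$ with $[I,\mathcal P]+I\mathcal P+\mathcal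 P I\subset I$. $\mathcal P$ is gr-simple if $[\mathcal P,\mathcal P]+\mathcal P\mathcal P\neq0$ and its only graded ideals are $\{0\}$ and $\mathcal P$. The centre is $Z(\mathcal P)=\{x\in\mathcal P:[x,\mathcal P]+x\mathcal P+\mathcal Px=0\}$. For each $\lambda\in\Lambda_{\mathcal S}$ introduce a new symbol $\tilde\lambda\notin\Lambda_{\mathcal S}$; $\widetilde{\Lambda_{\mathcal S}}=\{\tilde\lambda:\lambda\in\Lambda_{\mathcal S}\}$, $\tilde{\tilde\lambda}:=\lambda$, and for a subset $\Omega$ of $\Lambda_{\mathcal S}\dot\cup\widetilde{\Lambda_{\mathcal S}}$, $\tilde\Omega=\{\tilde x:x\in\Omega\}$. Define $\star:(\Lambda_{\mathcal S}\dot\cup\widetilde{\Lambda_{\mathcal S}})^2\to 2^{\Lambda_{\mathcal S}}$ by: for $\lambda,\mu\in\Lambda_{\mathcal S}$, $\lambda\star\mu=\emptyset$ if $[\mathcal P_\lambda,\mathcal P_\mu]+\mathcal P_\lambda\mathcal P_\mu=0$, and $\lambda\star\mu=\{\eta\}$ if $0\neq[\mathcal P_\lambda,\mathcal P_\mu]+\mathcal P_\lambda\mathcal P_\mu\subset\mathcal P_\eta$; $\lambda\star\tilde\mu=\tilde\mu\star\lambda=\{\eta\in\Lambda_{\mathcal S}:0\neq[\mathcal P_\eta,\mathcal P_\mu]+\mathcal P_\eta\mathcal P_\mu\subset\mathcal P_\lambda\}$; $\tilde\lambda\star\tilde\mu=\emptyset$. Distinguished element: fix $0$ such that either $0\in\Lambda_{\mathcal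 S}$ and $0\star\lambda\neq\{0\}$ for all $\lambda\in\Lambda_{\mathcal S}\setminus\{0\}$, or $0=\emptyset$, meaning no element is distinguished (then $\Lambda_{\mathcal S}\setminus\{0\}=\Lambda_{\mathcal S}$ and $\mathcal P_0:=\{0\}$). For $\Omega\subset(\Lambda_{\mathcal S}\dot\cup\widetilde{\Lambda_{\mathcal S}})\setminus\{0,\tilde0\}$ and $a\in\Lambda_{\mathcal S}\dot\cup\widetilde{\Lambda_{\mathcal S}}$ put $\psi(\emptyset,a)=\emptyset$ and, for $\Omega\neq\emptyset$, $\psi(\Omega,a)=\big(\bigcup_{x\in\Omega}(x\star a)\setminus\{0\}\big)\cup\big(\bigcup_{x\in\Omega}\widetilde{(x\star a)}\setminus\{\tilde0\}\big)$. For $\lambda,\mu\in\Lambda_{\mathcal S}\setminus\{0\}$, $\lambda$ is connected to $\mu$ ($\lambda\sim\mu$) if there are $\lambda_1,\dots,\lambda_n\in\Lambda_{\mathcal S}\dot\cup\widetilde{\Lambda_{\mathcal S}}$ such that: if $n=1$, $\lambda_1=\lambda=\mu$; if $n\ge2$, $\lambda_1\in\{\lambda,\tilde\lambda\}$ and, with $\Omega_1=\{\lambda_1\}$, $\Omega_i=\psi(\Omega_{i-1},\lambda_i)$, one has $\Omega_2,\dots,\Omega_{n-1}\neq\emptyset$ and $\mu\in\Omega_n$. The relation $\sim$ is an equivalence relation on $\Lambda_{\mathcal S}\setminus\{0\}$. $\mathcal P_0$ is tight if $\mathcal P_0=\{0\}$ or $\mathcal P_0=\sum_{\lambda,\mu\in\Lambda_{\mathcal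 S}\setminus\{0\},\ \lambda\star\mu=\{0\}}([\mathcal P_\lambda,\mathcal P_\mu]+\mathcal P_\lambda\mathcal P_\mu)$. With the convention $\mathcal P_{\tilde\lambda}:=\{0\}$ for $\lambda\in\Lambda_{\mathcal S}$, $\mathcal P$ is $\Lambda_{\mathcal S}$-multiplicative if whenever $\lambda,\mu\in\Lambda_{\mathcal S}$ satisfy $\lambda\in\mu\star s$ for some $s\in\Lambda_{\mathcal S}\dot\cup\widetilde{\Lambda_{\mathcal S}}$, then $\mathcal P_\lambda\subset[\mathcal P_\mu,\mathcal P_s+\mathcal P_{\tilde s}]+\mathcal P_\mu(\mathcal P_s+\mathcal P_{\tilde s})$. $\mathcal P$ is of maximal length if $\dim\mathcal P_\lambda=1$ for every $\lambda\in\Lambda_{\mathcal S}\setminus\{0\}$. *)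

theory Defs
  imports "HOL.Vector_Spaces" "HOL-Library.Set_Algebras"
begin

definition internal_direct_sum :: "'a::ab_group_add set \<Rightarrow> 's set \<Rightarrow> ('s \<Rightarrow> 'a set) \<Rightarrow> bool" where
  "internal_direct_sum V S W \<longleftrightarrow>
     (\<forall>s\<in>S. W s \<subseteq> V) \<and>
     (\<forall>x\<in>V. \<exists>!f. (\<forall>s\<in>S. f s \<in> W s) \<and> (\<forall>s. s \<notin> S \<longrightarrow> f s = 0) \<and>
                  finite {s\<in>S. f s \<noteq> 0} \<and> x = (\<Sum>s\<in>{s\<in>S. f s \<noteq> 0}. f s))"

locale nc_poisson_algebra = vector_space scale
  for scale :: "'f::field_char_0 \<Rightarrow> 'a::ab_group_add \<Rightarrow> 'a" (infixr "*s" 75) +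
  fixes br :: "'a \<Rightarrow> 'a \<Rightarrow> 'a" and mul :: "'a \<Rightarrow> 'a \<Rightarrow> 'a"
  assumes br_linear_left: "\<And>y. Vector_Spaces.linear scale scale (\<lambda>x. br x y)"
    and br_linear_right: "\<And>x. Vector_Spaces.linear scale scale (\<lambda>y. br x y)"
    and br_alternating: "\<And>x. br x x = 0"
    and jacobi: "\<And>x y z. br x (br y z) + br y (br z x) + br z (br x y) = 0"
    and mul_linear_left: "\<And>y. Vector_Spaces.linear scale scale (\<lambda>x. mul x y)"
    and mul_linear_right: "\<And>x. Vector_Spaces.linear scale scale (\<lambda>y. mul x y)"
    and mul_assoc: "\<And>x y z. mul (mul x y) z = mul x (mul y z)"
    and leibniz: "\<And>x y z. br x (mul y z) = mul (br x y) z + mul y (br x z)"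
begin

definition br_span :: "'a set \<Rightarrow> 'a set \<Rightarrow> 'a set" where
  "br_span A B = span {br a b | a b. a \<in> A \<and> b \<in> B}"

definition mul_span :: "'a set \<Rightarrow> 'a set \<Rightarrow> 'a set" where
  "mul_span A B = span {mul a b | a b. a \<in> A \<and> b \<in> B}"

text \<open>Here and below, \<open>+\<close> between sets is the elementwise (Minkowski) sum from
  \<^theory>\<open>HOL-Library.Set_Algebras\<close>.\<close>

definition prods :: "'a set \<Rightarrow> 'a set \<Rightarrow> 'a set" where
  "prods A B = br_span A B + mul_span A B"

definition centre :: "'a set" where
  "centre = {x. br_span {x} UNIV + mul_span {x} UNIV + mul_span UNIV {x} = {0}}"

end

datatype 's signed = Plain 's | Tilde 's

fun tilde :: "'s signed \<Rightarrow> 's signed" where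
  "tilde (Plain l) = Tilde l"
| "tilde (Tilde l) = Plain l"

locale set_graded_nc_poisson = nc_poisson_algebra scale br mul
  for scale :: "'f::field_char_0 \<Rightarrow> 'a::ab_group_add \<Rightarrow> 'a" (infixr "*s" 75)
    and br :: "'a \<Rightarrow> 'a \<Rightarrow> 'a" and mul :: "'a \<Rightarrow> 'a \<Rightarrow> 'a" +
  fixes S :: "'s set" and P :: "'s \<Rightarrow> 'a set"
  assumes index_nonempty: "S \<noteq> {}"
    and component_subspace: "\<And>s. s \<in> S \<Longrightarrow> subspace (P s)"
    and component_nonzero: "\<And>s. s \<in> S \<Longrightarrow> P s \<noteq> {0}"
    and decomposition: "internal_direct_sum UNIV S P"
    and graded: "\<And>s t. s \<in> S \<Longrightarrow> t \<in> S \<Longrightarrow> prods (P s) (P t) \<noteq> {0} \<Longrightarrow>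
                   \<exists>!u. u \<in> S \<and> prods (P s) (P t) \<subseteq> P u"
begin

definition supp :: "'s set" where
  "supp = {s \<in> S. P s \<noteq> {0}}"

definition signed_supp :: "'s signed set" where
  "signed_supp = Plain ` supp \<union> Tilde ` supp"

definition graded_ideal :: "'a set \<Rightarrow> bool" where
  "graded_ideal I \<longleftrightarrow> subspace I \<and> internal_direct_sum I S (\<lambda>s. I \<inter> P s) \<and>
     br_span I UNIV + mul_span I UNIV + mul_span UNIV I \<subseteq> I"

definition gr_simple :: bool where
  "gr_simple \<longleftrightarrow> prods UNIV UNIV \<noteq> {0} \<and> (\<forall>I. graded_ideal I \<longrightarrow> I = {0} \<or> I = UNIV)"

text \<open>By uniqueness of the target component, \<open>star (Plain l) (Plain m)\<close> has at most one
  element, for \<open>l\<close> and \<open>m\<close> in the support.\<close>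

fun star :: "'s signed \<Rightarrow> 's signed \<Rightarrow> 's set" where
  "star (Plain l) (Plain m) = {n \<in> supp. prods (P l) (P m) \<noteq> {0} \<and> prods (P l) (P m) \<subseteq> P n}"
| "star (Plain l) (Tilde m) = {n \<in> supp. prods (P n) (P m) \<noteq> {0} \<and> prods (P n) (P m) \<subseteq> P l}"
| "star (Tilde m) (Plain l) = {n \<in> supp. prods (P n) (P m) \<noteq> {0} \<and> prods (P n) (P m) \<subseteq> P l}"
| "star (Tilde l) (Tilde m) = {}"

text \<open>The distinguished index is an option \<open>z\<close>: \<open>None\<close> means that no index is distinguished.
  Accordingly \<open>set_option z\<close> plays the role of the set containing just the distinguished index.\<close>

definition distinguished :: "'s option \<Rightarrow> bool" where
  "distinguished z \<longleftrightarrow> (case z of None \<Rightarrow> True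
     | Some o' \<Rightarrow> o' \<in> supp \<and> (\<forall>l \<in> supp - {o'}. star (Plain o') (Plain l) \<noteq> {o'}))"

definition supp_nz :: "'s option \<Rightarrow> 's set" where
  "supp_nz z = supp - set_option z"

definition zero_component :: "'s option \<Rightarrow> 'a set" where
  "zero_component z = (case z of None \<Rightarrow> {0} | Some o' \<Rightarrow> P o')"

definition psi :: "'s option \<Rightarrow> 's signed set \<Rightarrow> 's signed \<Rightarrow> 's signed set" where
  "psi z \<Omega> a = Plain ` ((\<Union>x\<in>\<Omega>. star x a) - set_option z) \<union>
               Tilde ` ((\<Union>x\<in>\<Omega>. star x a) - set_option z)"

text \<open>Lists are indexed from 0, so \<open>chain z xs i\<close> is the set usually written \<open>\<Omega>\<close> with
  subscript \<open>i + 1\<close>.\<close>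

primrec chain :: "'s option \<Rightarrow> 's signed list \<Rightarrow> nat \<Rightarrow> 's signed set" where
  "chain z xs 0 = {xs ! 0}"
| "chain z xs (Suc i) = psi z (chain z xs i) (xs ! Suc i)"

definition connected :: "'s option \<Rightarrow> 's \<Rightarrow> 's \<Rightarrow> bool" where
  "connected z l m \<longleftrightarrow> l \<in> supp_nz z \<and> m \<in> supp_nz z \<and>
     (\<exists>xs. xs \<noteq> [] \<and> set xs \<subseteq> signed_supp \<and>
        (if length xs = 1 then xs ! 0 = Plain l \<and> l = m
         else xs ! 0 \<in> {Plain l, Tilde l} \<and>
              (\<forall>i. 1 \<le> i \<and> i < length xs - 1 \<longrightarrow> chain z xs i \<noteq> {}) \<and>
              Plain m \<in> chain z xs (length xs - 1)))"

text \<open>For \<open>z = None\<close> the first disjunct holds, so the second one only matters when an index is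
  distinguished.\<close>

definition tight :: "'s option \<Rightarrow> bool" where
  "tight z \<longleftrightarrow> zero_component z = {0} \<or>
     zero_component z = span (\<Union>{prods (P l) (P m) | l m.
        l \<in> supp_nz z \<and> m \<in> supp_nz z \<and> star (Plain l) (Plain m) = set_option z})"

fun signed_component :: "'s signed \<Rightarrow> 'a set" where
  "signed_component (Plain l) = P l"
| "signed_component (Tilde l) = {0}"

definition multiplicative :: bool where
  "multiplicative \<longleftrightarrow> (\<forall>l\<in>supp. \<forall>m\<in>supp. \<forall>s\<in>signed_supp. l \<in> star (Plain m) s \<longrightarrow>
     P l \<subseteq> prods (P m) (signed_component s + signed_component (tilde s)))"

definition maximal_length :: "'s option \<Rightarrow> bool" where
  "maximal_length z \<longleftrightarrow> (\<forall>l \<in> supp_nz z. dim (P l) = 1)"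

end

end

theory Submission imports Defs begin

text \<open>
  If all nonzero indices are connected, a graded ideal containing one component with nonzero index
  contains everything: multiplicativity transports it along connections, and tightness yields the
  zero component. A graded ideal inside the zero component annihilates all components and is
  therefore central, hence zero.

  Conversely, let \<open>C\<close> be the set of indices to which a nonzero \<open>l\<close> is connected. The span of the
  components in \<open>C\<close> and of their mutual products is a graded ideal. Since the associative product is
  not commutative, \<open>star\<close> on plain indices is not symmetric, and neither is a single step of a
  connection. The only products that could leave the ideal for this reason involve the zero
  component, and those are controlled by one-dimensionality and multiplicativity: if the product
  of the zero component with a nonzero index \<open>m\<close> lands in \<open>h\<close>, so does the product in the opposite
  order, and the product of \<open>m\<close> with the zero component never lands in the zero component.
\<close>

section \<open>Ideals and annihilators in an ungraded non-commutative Poisson algebra\<close>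

context nc_poisson_algebra
begin

lemma br_hom [simp]:
  "br (x + y) w = br x w + br y w" "br w (x + y) = br w x + br w y"
  "br (c *s x) w = c *s br x w" "br w (c *s x) = c *s br w x"
  "br 0 w = 0" "br w 0 = 0"
proof -
  note l = br_linear_left[of w, unfolded linear_iff_module_hom]
    and r = br_linear_right[of w, unfolded linear_iff_module_hom]
  show "br (x + y) w = br x w + br y w" "br w (x + y) = br w x + br w y"
    "br (c *s x) w = c *s br x w" "br w (c *s x) = c *s br w x"
    "br 0 w = 0" "br w 0 = 0"
    using module_hom.add[OF l] module_hom.add[OF r] module_hom.scale[OF l] module_hom.scale[OF r]
      module_hom.zero[OF l] module_hom.zero[OF r] by simp_all
qed

lemma mul_hom [simp]:
  "mul (x + y) w = mul x w + mul y w" "mul w (x + y) = mul w x + mul w y"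
  "mul (c *s x) w = c *s mul x w" "mul w (c *s x) = c *s mul w x"
  "mul 0 w = 0" "mul w 0 = 0"
proof -
  note l = mul_linear_left[of w, unfolded linear_iff_module_hom]
    and r = mul_linear_right[of w, unfolded linear_iff_module_hom]
  show "mul (x + y) w = mul x w + mul y w" "mul w (x + y) = mul w x + mul w y"
    "mul (c *s x) w = c *s mul x w" "mul w (c *s x) = c *s mul w x"
    "mul 0 w = 0" "mul w 0 = 0"
    using module_hom.add[OF l] module_hom.add[OF r] module_hom.scale[OF l] module_hom.scale[OF r]
      module_hom.zero[OF l] module_hom.zero[OF r] by simp_all
qed

lemma br_anticommute: "br y x = - br x y"
proof -
  have "br (x + y) (x + y) = 0" by (rule br_alternating)
  then have "br x y + br y x = 0"
    unfolding br_hom by (simp add: br_alternating add.commute)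
  then show ?thesis by (simp add: eq_neg_iff_add_eq_0 add.commute)
qed

lemma br_diff [simp]: "br w (x - y) = br w x - br w y"
  by (metis br_hom(2) add_diff_cancel_right' diff_add_cancel)

text \<open>For \<open>I = {0}\<close> this is the annihilator of \<open>x\<close>. The product
  \<open>br p x\<close> is left out because it is the negative of \<open>br x p\<close>.\<close>

definition absorbed :: "'a set \<Rightarrow> 'a \<Rightarrow> 'a set" where
  "absorbed I x = {p. br x p \<in> I \<and> mul x p \<in> I \<and> mul p x \<in> I}"

lemma subspace_absorbed: "subspace I \<Longrightarrow> subspace (absorbed I x)"
  unfolding absorbed_def
  by (rule subspaceI) (auto simp: subspace_add subspace_scale subspace_0)

text \<open>A subspace \<open>I\<close> is an ideal exactly if it is contained in its
  \<open>idealizer\<close>, and \<open>idealizer {0}\<close> is the centre. Going through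
  \<open>absorbed\<close> reduces membership of \<open>x\<close> to a check on each component of the
  grading.\<close>

definition idealizer :: "'a set \<Rightarrow> 'a set" where
  "idealizer I = {x. absorbed I x = UNIV}"

lemma idealizer_iff: "x \<in> idealizer I \<longleftrightarrow> (\<forall>p. br x p \<in> I \<and> mul x p \<in> I \<and> mul p x \<in> I)"
  unfolding idealizer_def absorbed_def by blast

lemma subspace_idealizer: "subspace I \<Longrightarrow> subspace (idealizer I)"
  by (rule subspaceI) (auto simp: subspace_add subspace_scale subspace_0 idealizer_iff)

text \<open>The Jacobi identity, the Leibniz rule and associativity rewrite every product of
  \<open>br x y\<close> or \<open>mul x y\<close> with \<open>p\<close> so that \<open>x\<close> or
  \<open>y\<close> becomes an outermost factor. A span of components and their products is thus an
  ideal once the components alone absorb multiplication.\<close>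

lemma products_in_idealizer:
  assumes I: "subspace I" and x: "x \<in> idealizer I" and y: "y \<in> idealizer I"
  shows "br x y \<in> idealizer I" "mul x y \<in> idealizer I"
proof -
  note [simp] = x[unfolded idealizer_iff, rule_format] y[unfolded idealizer_iff, rule_format]
  have neg [simp]: "br p x \<in> I" "br p y \<in> I" for p
    using br_anticommute[of p] subspace_neg[OF I] x y by (auto simp: idealizer_iff)
  have [simp]: "br (br x y) p \<in> I" for p
  proof -
    have "br (br x y) p = - br p (br x y)" by (rule br_anticommute)
    also have "\<dots> = br x (br y p) + br y (br p x)"
      using jacobi[of p x y] by (simp add: algebra_simps eq_neg_iff_add_eq_0 neg_eq_iff_add_eq_0)
    also have "\<dots> \<in> I" by (intro subspace_add I) simp_all
    finally show ?thesis .
  qed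
  have "mul (br x y) p \<in> I" for p
  proof -
    have "mul (br x y) p = br x (mul y p) - mul y (br x p)" by (simp add: leibniz)
    then show ?thesis using subspace_diff[OF I] by simp
  qed
  moreover have "mul p (br x y) \<in> I" for p
  proof -
    have "mul p (br x y) = br x (mul p y) - mul (br x p) y" by (simp add: leibniz)
    then show ?thesis using subspace_diff[OF I] by simp
  qed
  ultimately show "br x y \<in> idealizer I" by (simp add: idealizer_iff)
  have "br (mul x y) p \<in> I" for p
  proof -
    have "br (mul x y) p = - (mul (br p x) y + mul x (br p y))"
      using br_anticommute[of "mul x y" p] by (simp add: leibniz)
    then show ?thesis by (simp add: subspace_add subspace_neg I del: minus_add_distrib)
  qed
  moreover have "mul p (mul x y) \<in> I" for p
    using mul_assoc[of p x y, symmetric] by simp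
  ultimately show "mul x y \<in> idealizer I" by (simp add: idealizer_iff mul_assoc)
qed

text \<open>The annihilator of \<open>x\<close> is a subalgebra, by the same three identities. With
  tightness, annihilating the nonzero components therefore implies annihilating the zero
  component.\<close>

lemma products_in_absorbed:
  assumes x: "p \<in> absorbed {0} x" and y: "q \<in> absorbed {0} x"
  shows "br p q \<in> absorbed {0} x" "mul p q \<in> absorbed {0} x"
proof -
  have x': "br x p = 0" "mul x p = 0" "mul p x = 0" and y': "br x q = 0" "mul x q = 0" "mul q x = 0"
    using x y by (auto simp: absorbed_def)
  have n: "br p x = 0" "br q x = 0" using x' y' br_anticommute[of _ x] by auto
  have "br x (br p q) = 0" using jacobi[of x p q] n x' by simp
  moreover have "mul (br p q) x = 0" using leibniz[of p q x] n y' by simp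
  moreover have "mul x (br p q) = 0" using leibniz[of p x q] n y' by simp
  ultimately show "br p q \<in> absorbed {0} x" by (simp add: absorbed_def)
  have "mul x (mul p q) = 0" using mul_assoc[of x p q] x' by simp
  then show "mul p q \<in> absorbed {0} x" using x' y' by (simp add: absorbed_def leibniz mul_assoc)
qed

lemma idealizer_0_subset_centre: "idealizer {0} \<subseteq> centre"
proof
  fix x assume "x \<in> idealizer {0}"
  then have x: "br x p = 0" "mul x p = 0" "mul p x = 0" for p by (auto simp: idealizer_iff)
  then have "br_span {x} UNIV = {0}" "mul_span {x} UNIV = {0}" "mul_span UNIV {x} = {0}"
    by (auto simp: br_span_def mul_span_def)
  then show "x \<in> centre" by (simp add: centre_def set_plus_def)
qed

lemma prods_eq_span:
  "prods A B = span ({br a b |a b. a \<in> A \<and> b \<in> B} \<union> {mul a b |a b. a \<in> A \<and> b \<in> B})"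
  unfolding prods_def br_span_def mul_span_def span_Un set_plus_def by blast

lemma subspace_prods: "subspace (prods A B)"
  unfolding prods_eq_span by (rule subspace_span)

lemma br_in_prods: "a \<in> A \<Longrightarrow> b \<in> B \<Longrightarrow> br a b \<in> prods A B"
  and mul_in_prods: "a \<in> A \<Longrightarrow> b \<in> B \<Longrightarrow> mul a b \<in> prods A B"
  unfolding prods_eq_span by (blast intro: span_base)+

lemma prods_subsetI:
  assumes "subspace V" "\<And>a b. a \<in> A \<Longrightarrow> b \<in> B \<Longrightarrow> br a b \<in> V"
    "\<And>a b. a \<in> A \<Longrightarrow> b \<in> B \<Longrightarrow> mul a b \<in> V"
  shows "prods A B \<subseteq> V"
  unfolding prods_eq_span using assms by (intro span_minimal) auto

text \<open>Lets a span of products with a fixed right factor \<open>e\<close> be described by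
  single products \<open>mul p e\<close> instead of sums.\<close>

lemma subspace_image_mul:
  assumes "subspace V"
  shows "subspace ((\<lambda>p. mul p e) ` V)"
proof (rule subspaceI)
  show "0 \<in> (\<lambda>p. mul p e) ` V"
    using subspace_0[OF assms] by (rule rev_image_eqI) simp
next
  fix x y assume "x \<in> (\<lambda>p. mul p e) ` V" "y \<in> (\<lambda>p. mul p e) ` V"
  then show "x + y \<in> (\<lambda>p. mul p e) ` V"
    using subspace_add[OF assms] by (force simp flip: mul_hom)
next
  fix c x assume "x \<in> (\<lambda>p. mul p e) ` V"
  then show "c *s x \<in> (\<lambda>p. mul p e) ` V"
    using subspace_scale[OF assms] by (force simp flip: mul_hom)
qed

end

section \<open>Homogeneous components and graded subspaces\<close>

context set_graded_nc_poisson
begin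

lemma supp_eq: "supp = S"
  using component_nonzero by (auto simp: supp_def)

definition decomposes :: "'a \<Rightarrow> ('s \<Rightarrow> 'a) \<Rightarrow> bool" where
  "decomposes x f \<longleftrightarrow> (\<forall>s\<in>S. f s \<in> P s) \<and> (\<forall>s. s \<notin> S \<longrightarrow> f s = 0) \<and>
     finite {s\<in>S. f s \<noteq> 0} \<and> x = (\<Sum>s\<in>{s\<in>S. f s \<noteq> 0}. f s)"

definition proj :: "'a \<Rightarrow> 's \<Rightarrow> 'a" where
  "proj x = (THE f. decomposes x f)"

lemma decomposes_unique: "\<exists>!f. decomposes x f"
  using decomposition unfolding internal_direct_sum_def decomposes_def by simp

lemma decomposes_proj: "decomposes x (proj x)"
  unfolding proj_def by (rule theI'[OF decomposes_unique])

lemma proj_eqI: "decomposes x f \<Longrightarrow> proj x = f"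
  using decomposes_unique decomposes_proj by blast

text \<open>The finite set \<open>A\<close> may be larger than the support of \<open>f\<close>,
  which matters for sums, where terms can cancel.\<close>

lemma decomposesI:
  assumes "\<And>s. s \<in> S \<Longrightarrow> f s \<in> P s" "\<And>s. s \<notin> S \<Longrightarrow> f s = 0"
    and "finite A" "\<And>s. s \<notin> A \<Longrightarrow> f s = 0" "x = sum f A"
  shows "decomposes x f"
proof -
  have sub: "{s\<in>S. f s \<noteq> 0} \<subseteq> A" using assms(4) by auto
  then have "sum f A = sum f {s\<in>S. f s \<noteq> 0}"
    using assms by (intro sum.mono_neutral_right) auto
  then have "x = sum f {s\<in>S. f s \<noteq> 0}" using assms(5) by (rule trans[rotated])
  then show ?thesis
    unfolding decomposes_def using assms(1,2) finite_subset[OF sub assms(3)] by blast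
qed

lemma proj_in: "s \<in> S \<Longrightarrow> proj x s \<in> P s"
  and proj_outside: "s \<notin> S \<Longrightarrow> proj x s = 0"
  and finite_proj: "finite {s\<in>S. proj x s \<noteq> 0}"
  and sum_proj: "x = (\<Sum>s\<in>{s\<in>S. proj x s \<noteq> 0}. proj x s)"
  using decomposes_proj[of x] by (auto simp: decomposes_def)

lemma sum_proj': "finite A \<Longrightarrow> {s\<in>S. proj x s \<noteq> 0} \<subseteq> A \<Longrightarrow> sum (proj x) A = x"
  by (subst (2) sum_proj, rule sum.mono_neutral_right) (use proj_outside in auto)

lemma proj_add: "proj (x + y) = (\<lambda>s. proj x s + proj y s)"
  by (rule proj_eqI, rule decomposesI[where A = "{s\<in>S. proj x s \<noteq> 0} \<union> {s\<in>S. proj y s \<noteq> 0}"])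
    (auto simp: proj_in proj_outside finite_proj sum.distrib sum_proj'
      intro!: subspace_add component_subspace)

lemma proj_scale: "proj (c *s x) = (\<lambda>s. c *s proj x s)"
  by (rule proj_eqI, rule decomposesI[where A = "{s\<in>S. proj x s \<noteq> 0}"])
    (auto simp: proj_in proj_outside finite_proj sum_proj' simp flip: scale_sum_right
      intro!: subspace_scale component_subspace)

lemma proj_component: "t \<in> S \<Longrightarrow> x \<in> P t \<Longrightarrow> proj x = (\<lambda>s. if s = t then x else 0)"
  by (rule proj_eqI, rule decomposesI[where A = "{t}"])
    (auto simp: subspace_0 component_subspace)

lemma proj_zero: "proj 0 s = 0"
  using proj_scale[of 0 0] by simp

lemma subspace_proj: "subspace {x. proj x s = 0}"
  by (rule subspaceI) (auto simp: proj_add proj_scale proj_zero)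

lemma component_eq: "s \<in> S \<Longrightarrow> t \<in> S \<Longrightarrow> x \<in> P s \<Longrightarrow> x \<in> P t \<Longrightarrow> x \<noteq> 0 \<Longrightarrow> s = t"
  using proj_component[of s x] proj_component[of t x] by (metis (full_types))

lemma component_obtain:
  assumes "s \<in> S" obtains x where "x \<in> P s" "x \<noteq> 0"
  using component_nonzero[OF assms] subspace_0[OF component_subspace[OF assms]] by blast

lemma UNIV_subsetI:
  assumes "subspace V" "\<And>s. s \<in> S \<Longrightarrow> P s \<subseteq> V"
  shows "V = UNIV"
proof -
  have "x \<in> V" for x
    by (subst sum_proj, rule subspace_sum[OF assms(1)]) (use assms(2) proj_in in auto)
  then show ?thesis by blast
qed

text \<open>The elements all of whose projections stay in \<open>span G\<close> form a subspace; it
  contains \<open>G\<close>, since a homogeneous element projects to itself or to 0.\<close>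

lemma internal_direct_sum_homogeneous:
  assumes "G \<subseteq> (\<Union>s\<in>S. P s)"
  shows "internal_direct_sum (span G) S (\<lambda>s. span G \<inter> P s)"
proof -
  have "subspace {x. \<forall>s. proj x s \<in> span G}"
    by (rule subspaceI) (auto simp: proj_add proj_scale proj_zero span_zero span_add span_scale)
  moreover have "G \<subseteq> {x. \<forall>s. proj x s \<in> span G}"
    using assms by (auto simp: proj_component span_zero span_base)
  ultimately have "span G \<subseteq> {x. \<forall>s. proj x s \<in> span G}"
    by (intro span_minimal)
  then have *: "proj x s \<in> span G" if "x \<in> span G" for x s using that by blast
  have "\<exists>!f. (\<forall>s\<in>S. f s \<in> span G \<inter> P s) \<and> (\<forall>s. s \<notin> S \<longrightarrow> f s = 0) \<and>
      finite {s\<in>S. f s \<noteq> 0} \<and> x = (\<Sum>s\<in>{s\<in>S. f s \<noteq> 0}. f s)" if "x \<in> span G" for x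
  proof (rule ex1I[where a = "proj x"])
    show "(\<forall>s\<in>S. proj x s \<in> span G \<inter> P s) \<and> (\<forall>s. s \<notin> S \<longrightarrow> proj x s = 0) \<and>
      finite {s\<in>S. proj x s \<noteq> 0} \<and> x = (\<Sum>s\<in>{s\<in>S. proj x s \<noteq> 0}. proj x s)"
      using *[OF that] decomposes_proj[of x] by (simp add: decomposes_def)
  next
    fix f assume "(\<forall>s\<in>S. f s \<in> span G \<inter> P s) \<and> (\<forall>s. s \<notin> S \<longrightarrow> f s = 0) \<and>
      finite {s\<in>S. f s \<noteq> 0} \<and> x = (\<Sum>s\<in>{s\<in>S. f s \<noteq> 0}. f s)"
    then have "decomposes x f" by (simp add: decomposes_def)
    then show "f = proj x" using proj_eqI by simp
  qed
  then show ?thesis by (auto simp: internal_direct_sum_def)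
qed

lemma internal_direct_sum_subsetI:
  assumes "internal_direct_sum I S (\<lambda>s. I \<inter> P s)" "subspace V" "\<And>s. s \<in> S \<Longrightarrow> I \<inter> P s \<subseteq> V"
  shows "I \<subseteq> V"
proof
  fix x assume "x \<in> I"
  then obtain f where f: "\<forall>s\<in>S. f s \<in> I \<inter> P s" "x = (\<Sum>s\<in>{s\<in>S. f s \<noteq> 0}. f s)"
    using assms(1) unfolding internal_direct_sum_def by blast
  show "x \<in> V" unfolding f(2) using f(1) assms(3)
    by (intro subspace_sum[OF assms(2)]) blast
qed

section \<open>The partial multiplication of indices\<close>

text \<open>One ternary relation covers \<open>star\<close> for all signs, see
  \<open>star_iff_arrow\<close>. The order of \<open>a\<close> and \<open>b\<close> matters.\<close>

definition arrow :: "'s \<Rightarrow> 's \<Rightarrow> 's \<Rightarrow> bool" where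
  "arrow a b c \<longleftrightarrow> a \<in> S \<and> b \<in> S \<and> c \<in> S \<and> prods (P a) (P b) \<noteq> {0} \<and> prods (P a) (P b) \<subseteq> P c"

lemma arrowE:
  assumes "arrow a b c"
  obtains "a \<in> S" "b \<in> S" "c \<in> S"
  using assms by (auto simp: arrow_def)

lemma arrow_subset: "arrow a b c \<Longrightarrow> prods (P a) (P b) \<subseteq> P c"
  by (simp add: arrow_def)

lemma arrow_br: "arrow a b c \<Longrightarrow> x \<in> P a \<Longrightarrow> y \<in> P b \<Longrightarrow> br x y \<in> P c"
  and arrow_mul: "arrow a b c \<Longrightarrow> x \<in> P a \<Longrightarrow> y \<in> P b \<Longrightarrow> mul x y \<in> P c"
  by (rule subsetD[OF arrow_subset], assumption, intro br_in_prods mul_in_prods; assumption)+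

lemma prods_zero_or_arrow:
  assumes "a \<in> S" "b \<in> S"
  shows "prods (P a) (P b) = {0} \<or> (\<exists>c. arrow a b c)"
proof (cases "prods (P a) (P b) = {0}")
  case False
  obtain c where "c \<in> S" "prods (P a) (P b) \<subseteq> P c"
    using graded[OF assms False] by (elim ex1E conjE)
  then show ?thesis using assms False by (auto simp: arrow_def)
qed simp

text \<open>One nonzero element determines the target: the grading supplies some target
  \<open>d\<close>, and distinct components meet only in 0.\<close>

lemma arrowI:
  assumes "a \<in> S" "b \<in> S" "c \<in> S" "x \<in> prods (P a) (P b)" "x \<in> P c" "x \<noteq> 0"
  shows "arrow a b c"
proof -
  obtain d where d: "arrow a b d" using prods_zero_or_arrow assms by blast
  then have "d \<in> S" "x \<in> P d" using assms arrow_subset by (auto elim: arrowE)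
  then have "c = d" using assms component_eq by blast
  then show ?thesis using d by simp
qed

lemma arrow_unique:
  assumes "arrow a b c" "arrow a b d"
  shows "c = d"
proof -
  have S: "a \<in> S" "b \<in> S" "c \<in> S" "d \<in> S" using assms by (auto elim: arrowE)
  have "prods (P a) (P b) \<noteq> {0}" using assms by (simp add: arrow_def)
  then obtain x where x: "x \<in> prods (P a) (P b)" "x \<noteq> 0"
    using subspace_0[OF subspace_prods] by blast
  show ?thesis
    by (rule component_eq[of _ _ x]) (use S x arrow_subset assms in blast)+
qed

lemma star_iff_arrow:
  assumes "a \<in> S" "b \<in> S"
  shows "c \<in> star (Plain a) (Plain b) \<longleftrightarrow> arrow a b c"
    "c \<in> star (Plain a) (Tilde b) \<longleftrightarrow> arrow c b a"
    "c \<in> star (Tilde a) (Plain b) \<longleftrightarrow> arrow c a b"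
  using assms by (auto simp: supp_eq arrow_def)

text \<open>The bracket is antisymmetric, so only the associative product can break the symmetry of
  arrows.\<close>

lemma arrow_swap:
  assumes "arrow a b c" "x \<in> P a" "y \<in> P b" "br x y \<noteq> 0"
  shows "arrow b a c"
proof (rule arrowI)
  show "br y x \<in> prods (P b) (P a)" using assms br_in_prods by blast
  have "br x y \<in> P c" using arrow_br assms by blast
  then show "br y x \<in> P c"
    using br_anticommute[of y x] subspace_neg[OF component_subspace] assms(1)
    by (auto elim: arrowE)
  show "br y x \<noteq> 0" using br_anticommute[of y x] assms by simp
qed (use assms in \<open>auto elim: arrowE\<close>)

end

section \<open>Multiplicativity, one-dimensionality and the zero component\<close>

locale multiplicative_grading = set_graded_nc_poisson +
  fixes z :: "'c option"
  assumes distinguished: "distinguished z"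
    and multiplicative: multiplicative
    and maximal_length: "maximal_length z"
begin

lemma not_arrow_to_distinguished: "b \<notin> set_option z \<Longrightarrow> o' \<in> set_option z \<Longrightarrow> \<not> arrow o' b o'"
proof
  assume b: "b \<notin> set_option z" "o' \<in> set_option z" and a: "arrow o' b o'"
  have "star (Plain o') (Plain b) = {o'}"
    using a arrow_unique[OF a] star_iff_arrow by (blast elim: arrowE)
  then show False
    using distinguished b a by (auto simp: distinguished_def supp_eq elim: arrowE split: option.splits)
qed

text \<open>Multiplicativity with \<open>s = Tilde b\<close>: a factor can be recovered from the
  product by multiplying by \<open>P b\<close> again. Hence arrows can be reversed in
  \<open>arrow_reverse\<close>.\<close>

lemma arrow_source_subset:
  assumes "arrow a b c"
  shows "P a \<subseteq> prods (P c) (P b)"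
proof -
  have m: "a \<in> supp" "c \<in> supp" "Tilde b \<in> signed_supp" "a \<in> star (Plain c) (Tilde b)"
    using assms star_iff_arrow by (auto simp: supp_eq signed_supp_def arrow_def)
  then have "P a \<subseteq> prods (P c) (signed_component (Tilde b) + signed_component (tilde (Tilde b)))"
    using multiplicative unfolding multiplicative_def by blast
  then show ?thesis by simp
qed

lemma arrow_target_subset:
  assumes "arrow a b c"
  shows "P c \<subseteq> prods (P a) (P b)"
proof -
  have m: "a \<in> supp" "c \<in> supp" "Plain b \<in> signed_supp" "c \<in> star (Plain a) (Plain b)"
    using assms star_iff_arrow by (auto simp: supp_eq signed_supp_def arrow_def)
  then have "P c \<subseteq> prods (P a) (signed_component (Plain b) + signed_component (tilde (Plain b)))"
    using multiplicative unfolding multiplicative_def by blast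
  then show ?thesis by simp
qed

lemma arrow_reverse:
  assumes "arrow a b c"
  shows "arrow c b a"
proof -
  obtain x where "x \<in> P a" "x \<noteq> 0" using assms component_obtain by (auto elim: arrowE)
  then show ?thesis using assms arrow_source_subset[OF assms]
    by (intro arrowI[of _ _ _ x]) (auto elim: arrowE)
qed

lemma one_dimensional:
  assumes "m \<in> S" "m \<notin> set_option z"
  obtains e where "e \<in> P m" "e \<noteq> 0" "\<And>x. x \<in> P m \<Longrightarrow> \<exists>k. x = k *s e"
proof -
  have "dim (P m) = 1"
    using maximal_length assms by (auto simp: maximal_length_def supp_nz_def supp_eq)
  then obtain B where B: "B \<subseteq> P m" "independent B" "P m \<subseteq> span B" "card B = 1"
    using basis_exists by metis
  obtain e where "B = {e}" using B(4) by (auto simp: card_1_singleton_iff)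
  with B show ?thesis using that[of e] by (auto simp: span_singleton dependent_single)
qed

text \<open>A nonzero bracket can be swapped. Otherwise only associative products with a generator
  \<open>e\<close> of \<open>P m\<close> remain; going from \<open>P o'\<close> to
  \<open>P h\<close> and back multiplies by \<open>mul e e\<close> on the right, which forces
  \<open>mul e e\<close> into \<open>P o'\<close>. Then \<open>mul e (mul e e)\<close> is a nonzero
  product in the opposite order.\<close>

lemma arrow_distinguished_commute:
  assumes o': "o' \<in> set_option z" and m: "m \<notin> set_option z" and a: "arrow o' m h"
  shows "arrow m o' h"
proof (cases "\<exists>x\<in>P o'. \<exists>y\<in>P m. br x y \<noteq> 0")
  case True
  then show ?thesis using arrow_swap[OF a] by blast
next
  case False
  have S: "o' \<in> S" "m \<in> S" "h \<in> S" using a by (auto elim: arrowE)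
  obtain e where e: "e \<in> P m" "e \<noteq> 0" and dim1: "\<And>x. x \<in> P m \<Longrightarrow> \<exists>k. x = k *s e"
    using one_dimensional[OF S(2) m] by blast
  have so: "subspace (P o')" using component_subspace S by blast
  have br0: "br p e = 0" if "p \<in> P o'" for p using False that e by blast
  have "prods (P o') (P m) \<subseteq> (\<lambda>p. mul p e) ` P o'"
  proof (rule prods_subsetI[OF subspace_image_mul[OF so]])
    fix p b assume pb: "p \<in> P o'" "b \<in> P m"
    then obtain k where k: "b = k *s e" using dim1 by blast
    show "br p b \<in> (\<lambda>p. mul p e) ` P o'"
      using False pb subspace_0[OF so] by (intro image_eqI[where x = 0]) auto
    show "mul p b \<in> (\<lambda>p. mul p e) ` P o'"
      using pb k subspace_scale[OF so] by (intro image_eqI[where x = "k *s p"]) auto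
  qed
  then have Ph: "\<exists>p\<in>P o'. y = mul p e" if "y \<in> P h" for y
    using arrow_target_subset[OF a] that by blast
  \<comment> \<open>A second multiplication by \<open>e\<close>; brackets vanish again by the
    Leibniz rule, because \<open>e\<close> has zero bracket with \<open>P o'\<close> and with
    itself.\<close>
  have "prods (P h) (P m) \<subseteq> (\<lambda>p. mul p (mul e e)) ` P o'"
  proof (rule prods_subsetI[OF subspace_image_mul[OF so]])
    fix y b assume yb: "y \<in> P h" "b \<in> P m"
    then obtain k p where k: "b = k *s e" "p \<in> P o'" "y = mul p e" using dim1 Ph by meson
    have "br e y = 0"
      using k(2) br0 br_anticommute[of e p] by (simp add: k leibniz br_alternating)
    then have "br y b = 0" using br_anticommute[of y e] k by simp
    then show "br y b \<in> (\<lambda>p. mul p (mul e e)) ` P o'"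
      using subspace_0[OF so] by (intro image_eqI[where x = 0]) auto
    show "mul y b \<in> (\<lambda>p. mul p (mul e e)) ` P o'"
      using k subspace_scale[OF so] by (intro image_eqI[where x = "k *s p"]) (auto simp: mul_assoc)
  qed
  then have Po: "\<exists>p\<in>P o'. q = mul p (mul e e)" if "q \<in> P o'" for q
    using arrow_source_subset[OF a] that by blast
  obtain q where q: "q \<in> P o'" "q \<noteq> 0" using component_obtain S by blast
  obtain p where p: "p \<in> P o'" "q = mul p (mul e e)" using Po q by blast
  have "mul e e \<noteq> 0" using p q by auto
  then obtain k where k: "arrow m m k"
    using prods_zero_or_arrow[OF S(2) S(2)] mul_in_prods[OF e(1) e(1)] by auto
  then have kS: "k \<in> S" and ek: "mul e e \<in> P k" using arrow_mul e by (auto elim: arrowE)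
  \<comment> \<open>The nonzero \<open>q\<close> lies in \<open>P o'\<close> and is itself a product
    of \<open>P o'\<close> with \<open>P k\<close>. The property of the distinguished index leaves
    only \<open>k = o'\<close>.\<close>
  have "arrow o' k o'"
    by (rule arrowI[of _ _ _ q]) (use S kS p q ek mul_in_prods in auto)
  then have "k = o'" using not_arrow_to_distinguished[OF _ o'] o' by (cases z) auto
  then have eo: "mul e e \<in> P o'" using ek by simp
  \<comment> \<open>The square of \<open>e\<close> lies in the zero component and commutes with \<open>e\<close>.\<close>
  have ne: "mul e (mul e e) \<noteq> 0"
  proof
    assume "mul e (mul e e) = 0"
    \<comment> \<open>Every element of \<open>P h\<close> has this form: it is
      \<open>mul p e\<close>, and \<open>p\<close> in turn is
      \<open>mul p' (mul e e)\<close>.\<close>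
    then have *: "mul (mul p' (mul e e)) e = 0" for p' by (simp add: mul_assoc)
    obtain v where v: "v \<in> P h" "v \<noteq> 0" using component_obtain S by blast
    then show False using Ph Po * by metis
  qed
  show ?thesis
  proof (rule arrowI[of _ _ _ "mul e (mul e e)"])
    show "mul e (mul e e) \<in> P h" using arrow_mul[OF a eo e(1)] by (simp add: mul_assoc)
    show "mul e (mul e e) \<in> prods (P m) (P o')" using mul_in_prods e eo by blast
  qed (use S ne in auto)
qed

text \<open>The choice of the distinguished index excludes only the opposite order. Such an arrow
  would make all products of \<open>P o'\<close> with \<open>P m\<close> in the opposite order
  vanish, then \<open>mul e e\<close>, and finally the products of \<open>P m\<close> with
  \<open>P o'\<close>.\<close>

lemma not_arrow_distinguished:
  assumes o': "o' \<in> set_option z" and m: "m \<notin> set_option z"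
  shows "\<not> arrow m o' o'"
proof
  assume a: "arrow m o' o'"
  have S: "o' \<in> S" "m \<in> S" using a by (auto elim: arrowE)
  obtain e where e: "e \<in> P m" "e \<noteq> 0" and dim1: "\<And>x. x \<in> P m \<Longrightarrow> \<exists>k. x = k *s e"
    using one_dimensional[OF S(2) m] by blast
  have so: "subspace (P o')" using component_subspace S by blast
  \<comment> \<open>Commuting such an arrow and comparing targets with \<open>a\<close> would give
    \<open>u = o'\<close>, which is excluded.\<close>
  have no: "\<not> arrow o' m u" for u
    using arrow_distinguished_commute[OF o' m] arrow_unique[OF a] not_arrow_to_distinguished[OF m o']
    by blast
  then have "prods (P o') (P m) = {0}" using prods_zero_or_arrow S by blast
  then have p0: "br p e = 0" "mul p e = 0" if "p \<in> P o'" for p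
    using br_in_prods[OF that e(1)] mul_in_prods[OF that e(1)] by auto
  have "prods (P o') (P o') \<subseteq> {x. mul x e = 0}"
  proof (rule prods_subsetI)
    show "subspace {x. mul x e = 0}" by (rule subspaceI) auto
    fix p q assume "p \<in> P o'" "q \<in> P o'"
    then show "br p q \<in> {x. mul x e = 0}" "mul p q \<in> {x. mul x e = 0}"
      using leibniz[of p q e] p0 by (auto simp: mul_assoc)
  qed
  \<comment> \<open>Multiplicativity places \<open>e\<close> in the products of \<open>P o'\<close>
    with itself, which all kill \<open>e\<close> from the left.\<close>
  then have ee: "mul e e = 0"
    using arrow_source_subset[OF a] e by blast
  obtain q where q: "q \<in> P o'" "q \<noteq> 0" using component_obtain S by blast
  have "prods (P m) (P o') \<subseteq> {x. mul e x = 0}"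
  proof (rule prods_subsetI)
    show "subspace {x. mul e x = 0}" by (rule subspaceI) auto
    fix y p assume yp: "y \<in> P m" "p \<in> P o'"
    then obtain k where k: "y = k *s e" using dim1 by blast
    have "br y p = 0" using br_anticommute[of y p] k yp p0 by simp
    then show "br y p \<in> {x. mul e x = 0}" by simp
    show "mul y p \<in> {x. mul e x = 0}" using k ee mul_assoc[of e e p] by simp
  qed
  then have e0: "mul e p = 0" if "p \<in> P o'" for p
    using arrow_target_subset[OF a] that by blast
  have "prods (P m) (P o') \<subseteq> {0}"
  proof (rule prods_subsetI)
    show "subspace {0}" by (rule subspace_single_0)
    fix y p assume yp: "y \<in> P m" "p \<in> P o'"
    then obtain k where k: "y = k *s e" using dim1 by blast
    show "br y p \<in> {0}" "mul y p \<in> {0}" using br_anticommute[of y p] k yp p0 e0 by auto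
  qed
  then show False using a subspace_0[OF subspace_prods] by (auto simp: arrow_def)
qed

section \<open>Extending connections\<close>

lemma connected_refl:
  assumes "l \<in> supp_nz z"
  shows "connected z l l"
  unfolding connected_def using assms
  by (auto simp: supp_nz_def signed_supp_def intro!: exI[of _ "[Plain l]"])

lemma chain_append: "i < length xs \<Longrightarrow> chain z (xs @ ys) i = chain z xs i"
  by (induction i) (auto simp: nth_append)

text \<open>The list of a connection is extended by \<open>a\<close>. The sign of \<open>m\<close>
  can be chosen freely, since the sets of a chain after the first contain both signs of each
  index.\<close>

lemma connected_step:
  assumes lm: "connected z l m" and n: "n \<in> supp_nz z" and a: "a \<in> signed_supp"
    and st: "n \<in> star (Plain m) a \<or> n \<in> star (Tilde m) a"
  shows "connected z l n"
proof -
  obtain xs where l: "l \<in> supp_nz z" and ne: "xs \<noteq> []" and xs: "set xs \<subseteq> signed_supp"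
    and c: "if length xs = 1 then xs ! 0 = Plain l \<and> l = m
         else xs ! 0 \<in> {Plain l, Tilde l} \<and>
              (\<forall>i. 1 \<le> i \<and> i < length xs - 1 \<longrightarrow> chain z xs i \<noteq> {}) \<and>
              Plain m \<in> chain z xs (length xs - 1)"
    using lm unfolding connected_def by blast
  have psi: "Plain n \<in> psi z \<Omega> a" if "x \<in> \<Omega>" "n \<in> star x a" for x \<Omega>
    using that n by (auto simp: psi_def supp_nz_def)
  show ?thesis
  proof (cases "length xs = 1")
    case True
    then have [simp]: "l = m" using c by simp
    \<comment> \<open>A list of length one must be \<open>[Plain l]\<close>, but a longer one may
      start with either sign, so the new list is \<open>[x, a]\<close>.\<close>
    obtain x where x: "x = Plain m \<or> x = Tilde m" "n \<in> star x a" using st by blast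
    have "x \<in> signed_supp" using x l by (auto simp: supp_nz_def signed_supp_def)
    then show ?thesis
      unfolding connected_def using l n a x psi[of x "{x}"]
      by (intro conjI exI[of _ "[x, a]"]) auto
  next
    case False
    define k where "k = length xs - 1"
    have k: "length xs = Suc k" "1 \<le> k" using False ne by (auto simp: k_def neq_Nil_conv Suc_le_eq)
    have m: "Plain m \<in> chain z xs k" and x0: "xs ! 0 \<in> {Plain l, Tilde l}"
      and nonempty: "\<And>i. 1 \<le> i \<Longrightarrow> i < k \<Longrightarrow> chain z xs i \<noteq> {}"
      using c False k by auto
    obtain k' where k': "k = Suc k'" using k by (cases k) auto
    have "Tilde m \<in> chain z xs k" using m unfolding k' by (auto simp: psi_def)
    then have "Plain n \<in> psi z (chain z xs k) a" using m st psi by blast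
    moreover have "chain z (xs @ [a]) (Suc k) = psi z (chain z xs k) a"
      using chain_append[of k xs "[a]"] k by (simp add: nth_append)
    moreover have "chain z (xs @ [a]) i \<noteq> {}" if "1 \<le> i" "i < Suc k" for i
      using nonempty[of i] m that chain_append[of i xs "[a]"] k by (cases "i = k") auto
    ultimately show ?thesis
      unfolding connected_def using l n xs a x0 k
      by (intro conjI exI[of _ "xs @ [a]"]) (auto simp: nth_append)
  qed
qed

lemma supp_nz_iff: "m \<in> supp_nz z \<longleftrightarrow> m \<in> S \<and> m \<notin> set_option z"
  by (auto simp: supp_nz_def supp_eq)

lemma connected_nz: "connected z l m \<Longrightarrow> m \<in> S \<and> m \<notin> set_option z"
  by (auto simp: connected_def supp_nz_iff)

text \<open>The index \<open>m\<close> enters as a left factor with \<open>Plain m\<close> and as a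
  right factor with \<open>Tilde m\<close>. The case \<open>arrow m n a\<close> is missing: no
  choice of signs makes \<open>n\<close> a right factor.\<close>

lemma connected_arrow:
  assumes "connected z l m" "n \<in> S" "n \<notin> set_option z"
  shows "arrow m a n \<Longrightarrow> connected z l n"
    and "arrow n m a \<Longrightarrow> connected z l n"
proof -
  have n: "n \<in> supp_nz z" and m: "m \<in> S"
    using assms connected_nz by (auto simp: supp_nz_iff)
  note step = connected_step[OF assms(1) n, of "Plain a"]
  {
    assume "arrow m a n"
    then have "a \<in> S" "n \<in> star (Plain m) (Plain a)"
      using star_iff_arrow(1) by (auto simp del: star.simps elim: arrowE)
    then show "connected z l n" using step by (auto simp: signed_supp_def supp_eq simp del: star.simps)
  next
    assume "arrow n m a"
    then have "a \<in> S" "n \<in> star (Tilde m) (Plain a)"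
      using star_iff_arrow(3) by (auto simp del: star.simps elim: arrowE)
    then show "connected z l n" using step by (auto simp: signed_supp_def supp_eq simp del: star.simps)
  }
qed

section \<open>Gr-simplicity implies connectedness\<close>

lemma connected_if_gr_simple:
  assumes simple: gr_simple and l: "l \<in> supp_nz z" and n: "n \<in> supp_nz z"
  shows "connected z l n"
proof (rule ccontr)
  assume not: "\<not> connected z l n"
  define C where "C = {m. connected z l m}"
  \<comment> \<open>The products are added because they may land in the zero component, whose index
    is never in \<open>C\<close>.\<close>
  define G where "G = (\<Union>m\<in>C. P m) \<union> (\<Union>m\<in>C. \<Union>n\<in>C. prods (P m) (P n))"
  define I where "I = span G"
  have CS: "C \<subseteq> S" using connected_nz by (auto simp: C_def)
  have G: "\<exists>s\<in>S. x \<in> P s \<and> s \<noteq> n" if x: "x \<in> G" for x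
  proof -
    consider m where "m \<in> C" "x \<in> P m" | m k where "m \<in> C" "k \<in> C" "x \<in> prods (P m) (P k)"
      using x by (auto simp: G_def)
    then show ?thesis
    proof cases
      case 1
      then show ?thesis using CS not by (auto simp: C_def)
    next
      case 2
      show ?thesis
      proof (cases "x = 0")
        \<comment> \<open>The zero vector lies in every component, so any index of \<open>C\<close>
          serves as one different from \<open>n\<close>.\<close>
        case True
        obtain s where "s \<in> C" using connected_refl[OF l] by (auto simp: C_def)
        then have "s \<in> S" "s \<noteq> n" using CS not by (auto simp: C_def)
        then show ?thesis using True subspace_0[OF component_subspace] by blast
      next
        case False
        then obtain h where h: "arrow m k h"
          using prods_zero_or_arrow[of m k] 2 CS by auto
        then have "h \<noteq> n"
          using connected_arrow(1)[of l m n k] n not 2 by (auto simp: C_def supp_nz_iff)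
        then show ?thesis using h 2 arrow_subset[OF h] by (auto elim: arrowE)
      qed
    qed
  qed
  have sI: "subspace I" by (simp add: I_def)
  have PC: "P m \<subseteq> I" if "m \<in> C" for m
    using that by (auto simp: I_def G_def intro!: span_base)
  have PCC: "prods (P m) (P k) \<subseteq> I" if "m \<in> C" "k \<in> C" for m k
    using that by (auto simp: I_def G_def intro!: span_base)
  have right: "prods (P m) (P k) \<subseteq> I" if m: "m \<in> C" and k: "k \<in> S" for m k
  proof (cases "\<exists>h. arrow m k h")
    case False
    then have "prods (P m) (P k) = {0}" using prods_zero_or_arrow m k CS by blast
    then show ?thesis using subspace_0[OF sI] by simp
  next
    case True
    then obtain h where h: "arrow m k h" by blast
    have mnz: "m \<notin> set_option z" using m connected_nz by (auto simp: C_def)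
    show ?thesis
    proof (cases "h \<in> set_option z")
      case False
      then have "h \<in> C" using connected_arrow(1)[of l m h k] h m by (auto simp: C_def elim: arrowE)
      then show ?thesis using arrow_subset[OF h] PC by blast
    next
      case True
      have knz: "k \<notin> set_option z"
        using not_arrow_distinguished[OF True mnz] True h by (cases z) auto
      \<comment> \<open>The product of \<open>m\<close> and \<open>k\<close> lands in the zero index
        \<open>h\<close>. Reversing, commuting past \<open>h\<close> and reversing again yields
        \<open>arrow m h k\<close>, which is a step from \<open>m\<close> to
        \<open>k\<close>.\<close>
      have "arrow k h m"
        using arrow_distinguished_commute[OF True knz arrow_reverse[OF h]] .
      then have "arrow m h k" by (rule arrow_reverse)
      then have "k \<in> C" using connected_arrow(1)[of l m k h] k knz m by (auto simp: C_def)
      then show ?thesis using PCC m by blast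
    qed
  qed
  have left: "prods (P k) (P m) \<subseteq> I" if m: "m \<in> C" and k: "k \<in> S" for m k
  proof (cases "\<exists>h. arrow k m h")
    case False
    then have "prods (P k) (P m) = {0}" using prods_zero_or_arrow m k CS by blast
    then show ?thesis using subspace_0[OF sI] by simp
  next
    case True
    then obtain h where h: "arrow k m h" by blast
    have mnz: "m \<notin> set_option z" using m connected_nz by (auto simp: C_def)
    show ?thesis
    proof (cases "k \<in> set_option z")
      case False
      then have "k \<in> C" using connected_arrow(2)[of l m k h] h k m by (auto simp: C_def)
      then show ?thesis using PCC m by blast
    next
      case True
      have "arrow m k h" using arrow_distinguished_commute[OF True mnz h] .
      moreover have "h \<notin> set_option z"
        using not_arrow_to_distinguished[OF mnz True] h True by (cases z) auto
      ultimately have "h \<in> C"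
        using connected_arrow(1)[of l m h k] m h by (auto simp: C_def elim: arrowE)
      then show ?thesis using arrow_subset[OF h] PC by blast
    qed
  qed
  have A: "x \<in> idealizer I" if "m \<in> C" "x \<in> P m" for m x
    unfolding idealizer_def mem_Collect_eq
  proof (rule UNIV_subsetI[OF subspace_absorbed[OF sI]])
    fix k assume k: "k \<in> S"
    show "P k \<subseteq> absorbed I x"
    proof
      fix p assume "p \<in> P k"
      then have "br x p \<in> I" "mul x p \<in> I" "mul p x \<in> I"
        by (intro subsetD[OF right[OF that(1) k]] subsetD[OF left[OF that(1) k]]
          br_in_prods mul_in_prods that(2); assumption)+
      then show "p \<in> absorbed I x" by (simp add: absorbed_def)
    qed
  qed
  have "prods (P m) (P k) \<subseteq> idealizer I" if "m \<in> C" "k \<in> C" for m k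
    by (intro prods_subsetI subspace_idealizer sI products_in_idealizer
        A[OF that(1)] A[OF that(2)])
  then have "G \<subseteq> idealizer I" using A unfolding G_def by blast
  then have "I \<subseteq> idealizer I"
    using span_minimal subspace_idealizer[OF sI] unfolding I_def by blast
  then have "br_span I UNIV \<subseteq> I" "mul_span I UNIV \<subseteq> I" "mul_span UNIV I \<subseteq> I"
    unfolding br_span_def mul_span_def
    by (intro span_minimal sI; auto simp: idealizer_iff subset_iff)+
  then have "br_span I UNIV + mul_span I UNIV + mul_span UNIV I \<subseteq> I"
    using subspace_add[OF sI] by (fastforce elim!: set_plus_elim)
  then have "graded_ideal I"
    using G internal_direct_sum_homogeneous[of G] sI by (auto simp: graded_ideal_def I_def)
  moreover have "I \<noteq> {0}"
  proof -
    have "l \<in> C" using connected_refl l by (simp add: C_def)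
    then have "P l \<subseteq> I" "l \<in> S" using PC CS by auto
    then show ?thesis using component_obtain[of l] by auto
  qed
  ultimately have "I = UNIV" using simple by (auto simp: gr_simple_def)
  \<comment> \<open>All generators are homogeneous of index other than \<open>n\<close>, so the
    ideal misses the nonzero component \<open>P n\<close>.\<close>
  moreover have "I \<subseteq> {x. proj x n = 0}"
    unfolding I_def
  proof (intro span_minimal subspace_proj subsetI)
    fix x assume "x \<in> G"
    then show "x \<in> {x. proj x n = 0}" using G[of x] by (auto simp: proj_component)
  qed
  ultimately have *: "proj x n = 0" for x by blast
  obtain x where "x \<in> P n" "x \<noteq> 0" using component_obtain[of n] n by (auto simp: supp_nz_iff)
  then show False using fun_cong[OF proj_component, of n x n] *[of x] n by (simp add: supp_nz_iff)
qed

section \<open>Connectedness implies gr-simplicity\<close>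

lemma graded_idealD:
  assumes "graded_ideal I"
  shows "x \<in> I \<Longrightarrow> br x p \<in> I" "x \<in> I \<Longrightarrow> mul x p \<in> I" "x \<in> I \<Longrightarrow> mul p x \<in> I"
    "x \<in> I \<Longrightarrow> br p x \<in> I"
proof -
  assume x: "x \<in> I"
  have sI: "subspace I" and sub: "br_span I UNIV + mul_span I UNIV + mul_span UNIV I \<subseteq> I"
    using assms by (auto simp: graded_ideal_def)
  have zero: "0 \<in> br_span A B" "0 \<in> mul_span A B" for A B
    by (auto simp: br_span_def mul_span_def span_zero)
  have "br x p \<in> br_span I UNIV" "mul x p \<in> mul_span I UNIV" "mul p x \<in> mul_span UNIV I"
    unfolding br_span_def mul_span_def using x by (blast intro: span_base)+
  then have "br x p + 0 + 0 \<in> I" "0 + mul x p + 0 \<in> I" "0 + 0 + mul p x \<in> I"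
    using sub zero by (blast intro: set_plus_intro)+
  then show "br x p \<in> I" "mul x p \<in> I" "mul p x \<in> I" by simp_all
  then show "br p x \<in> I" using br_anticommute[of p x] subspace_neg[OF sI] by simp
qed

text \<open>Induction along the chain: each \<open>star\<close> step is an arrow involving the
  current index \<open>k\<close>, and multiplicativity writes the next component as products with
  \<open>P k\<close>, as left or right factor.\<close>

lemma connected_component_in_ideal:
  assumes I: "graded_ideal I" and l: "P l \<subseteq> I" and c: "connected z l m"
  shows "P m \<subseteq> I"
proof -
  have sI: "subspace I" using I by (simp add: graded_ideal_def)
  have prods: "prods (P a) (P b) \<subseteq> I" if "P a \<subseteq> I \<or> P b \<subseteq> I" for a b
    using that graded_idealD[OF I] by (intro prods_subsetI sI) blast+
  obtain xs where xs: "set xs \<subseteq> signed_supp" "xs \<noteq> []"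
    and c: "if length xs = 1 then xs ! 0 = Plain l \<and> l = m
         else xs ! 0 \<in> {Plain l, Tilde l} \<and>
              (\<forall>i. 1 \<le> i \<and> i < length xs - 1 \<longrightarrow> chain z xs i \<noteq> {}) \<and>
              Plain m \<in> chain z xs (length xs - 1)"
    and lS: "l \<in> S"
    using c unfolding connected_def by (auto simp: supp_nz_iff)
  have start: "xs ! 0 \<in> {Plain l, Tilde l}" and fin: "Plain m \<in> chain z xs (length xs - 1)"
    using c by (auto split: if_splits)
  have "\<forall>h. Plain h \<in> chain z xs i \<or> Tilde h \<in> chain z xs i \<longrightarrow> h \<in> S \<and> P h \<subseteq> I"
    if "i < length xs" for i
    using that
  proof (induction i)
    case 0
    then show ?case using start l lS by auto
  next
    case (Suc i)
    have a: "xs ! Suc i \<in> signed_supp" using xs Suc.prems by auto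
    show ?case
    proof (intro allI impI)
      fix h assume "Plain h \<in> chain z xs (Suc i) \<or> Tilde h \<in> chain z xs (Suc i)"
      then obtain x where x: "x \<in> chain z xs i" "h \<in> star x (xs ! Suc i)"
        by (auto simp: psi_def)
      consider k b where "x = Plain k" "xs ! Suc i = Plain b" "b \<in> S"
        | k b where "x = Plain k" "xs ! Suc i = Tilde b" "b \<in> S"
        | k b where "x = Tilde k" "xs ! Suc i = Plain b" "b \<in> S"
        using a x(2) by (cases x) (auto simp: signed_supp_def supp_eq)
      then show "h \<in> S \<and> P h \<subseteq> I"
      proof cases
        case 1
        then have "k \<in> S" "P k \<subseteq> I" using Suc x by auto
        then have "arrow k b h" using 1 x star_iff_arrow by simp
        then show ?thesis using arrow_target_subset prods \<open>P k \<subseteq> I\<close> by (blast elim: arrowE)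
      next
        case 2
        then have "k \<in> S" "P k \<subseteq> I" using Suc x by auto
        then have "arrow h b k" using 2 x star_iff_arrow by simp
        then show ?thesis using arrow_source_subset prods \<open>P k \<subseteq> I\<close> by (blast elim: arrowE)
      next
        case 3
        then have "k \<in> S" "P k \<subseteq> I" using Suc x by auto
        then have "arrow h k b" using 3 x star_iff_arrow by simp
        then show ?thesis using arrow_source_subset prods \<open>P k \<subseteq> I\<close> by (blast elim: arrowE)
      qed
    qed
  qed
  then show ?thesis using fin xs by (metis diff_less length_greater_0_conv zero_less_one)
qed

lemma gr_simple_if_connected:
  assumes centreless: "centre = {0}" and tight: "tight z"
    and conn: "\<And>l m. l \<in> supp_nz z \<Longrightarrow> m \<in> supp_nz z \<Longrightarrow> connected z l m"
  shows gr_simple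
proof -
  have tightD: "P o' = span (\<Union>{prods (P l) (P m) | l m.
        l \<in> supp_nz z \<and> m \<in> supp_nz z \<and> star (Plain l) (Plain m) = set_option z})"
    if o': "o' \<in> set_option z" for o'
  proof -
    have [simp]: "z = Some o'" using o' by (cases z) auto
    have "o' \<in> S" using distinguished by (simp add: distinguished_def supp_eq)
    then show ?thesis using tight component_nonzero by (auto simp: tight_def zero_component_def)
  qed
  have "I = UNIV" if I: "graded_ideal I" and nonzero: "I \<noteq> {0}" for I
  proof -
    have sI: "subspace I" and dI: "internal_direct_sum I S (\<lambda>s. I \<inter> P s)"
      using I by (auto simp: graded_ideal_def)
    note Iprods = graded_idealD[OF I]
    \<comment> \<open>Otherwise \<open>I\<close> lies in the zero component, and a nonzero
      \<open>x\<close> in \<open>I\<close> turns out to be central.\<close>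
    have "\<exists>l\<in>supp_nz z. I \<inter> P l \<noteq> {0}"
    proof (rule ccontr)
      assume "\<not> ?thesis"
      then have none: "I \<inter> P l = {0}" if "l \<in> S" "l \<notin> set_option z" for l
        using that by (auto simp: supp_nz_iff)
      obtain x where x: "x \<in> I" "x \<noteq> 0" using nonzero subspace_0[OF sI] by blast
      have "z \<noteq> None"
        using internal_direct_sum_subsetI[OF dI subspace_single_0] none x by auto
      then obtain o' where z: "z = Some o'" by blast
      have o': "o' \<in> S" using distinguished by (simp add: z distinguished_def supp_eq)
      have IPo: "I \<subseteq> P o'"
      proof (rule internal_direct_sum_subsetI[OF dI component_subspace[OF o']])
        fix s assume "s \<in> S"
        then show "I \<inter> P s \<subseteq> P o'"
          using none[of s] subspace_0[OF component_subspace[OF o']] by (cases "s = o'") (auto simp: z)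
      qed
      \<comment> \<open>A nonzero product in \<open>I\<close> lies in \<open>P o'\<close> and would
        yield an arrow into \<open>o'\<close>.\<close>
      have trivial: "I \<inter> prods (P a) (P b) \<subseteq> {0}" if "a \<in> S" "b \<in> S" "\<not> arrow a b o'" for a b
        using that IPo arrowI[OF that(1,2) o'] by blast
      have nz: "P l \<subseteq> absorbed {0} x" if l: "l \<in> supp_nz z" for l
      proof -
        have lS: "l \<in> S" "l \<notin> set_option z" using l by (auto simp: supp_nz_iff)
        have "\<not> arrow o' l o'" "\<not> arrow l o' o'"
          using not_arrow_to_distinguished not_arrow_distinguished lS z by auto
        then have *: "I \<inter> prods (P o') (P l) \<subseteq> {0}" "I \<inter> prods (P l) (P o') \<subseteq> {0}"
          using trivial o' lS by auto
        have xo: "x \<in> P o'" using x IPo by blast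
        show ?thesis
        proof
          fix p assume p: "p \<in> P l"
          have "br x p \<in> {0}" "mul x p \<in> {0}" "mul p x \<in> {0}"
            by (intro subsetD[OF *(1)] subsetD[OF *(2)] IntI br_in_prods mul_in_prods xo p
              Iprods x(1))+
          then show "p \<in> absorbed {0} x" by (simp add: absorbed_def)
        qed
      qed
      have "prods (P l) (P m) \<subseteq> absorbed {0} x" if "l \<in> supp_nz z" "m \<in> supp_nz z" for l m
        using nz[OF that(1)] nz[OF that(2)] products_in_absorbed
        by (intro prods_subsetI subspace_absorbed subspace_single_0) blast+
      moreover have "o' \<in> set_option z" by (simp add: z)
      ultimately have "P o' \<subseteq> absorbed {0} x"
        unfolding tightD[OF \<open>o' \<in> set_option z\<close>]
        by (intro span_minimal subspace_absorbed subspace_single_0) blast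
      then have "absorbed {0} x = UNIV"
        using nz by (intro UNIV_subsetI subspace_absorbed) (auto simp: supp_nz_def supp_eq z)
      then have "x \<in> centre" using idealizer_0_subset_centre by (auto simp: idealizer_def)
      then show False using centreless x by simp
    qed
    then obtain l where l: "l \<in> supp_nz z" "I \<inter> P l \<noteq> {0}" by blast
    then have lS: "l \<in> S" "l \<notin> set_option z" by (auto simp: supp_nz_iff)
    obtain x where x: "x \<in> I" "x \<in> P l" "x \<noteq> 0"
      using l(2) subspace_0[OF sI] subspace_0[OF component_subspace[OF lS(1)]] by blast
    have "P l \<subseteq> I"
    proof
      obtain e where e: "\<And>x. x \<in> P l \<Longrightarrow> \<exists>k. x = k *s e"
        using one_dimensional[OF lS] by blast
      obtain k where k: "x = k *s e" using e x by blast
      then have "k \<noteq> 0" using x by auto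
      fix y assume "y \<in> P l"
      then obtain j where "y = j *s e" using e by blast
      \<comment> \<open>In a one-dimensional component the nonzero \<open>x\<close> already
        spans.\<close>
      then have "y = (j / k) *s x" using k \<open>k \<noteq> 0\<close> by simp
      then show "y \<in> I" using x subspace_scale[OF sI] by simp
    qed
    then have nz: "P m \<subseteq> I" if "m \<in> supp_nz z" for m
      using connected_component_in_ideal[OF I _ conn[OF l(1) that]] by blast
    show "I = UNIV"
    proof (rule UNIV_subsetI[OF sI])
      fix s assume s: "s \<in> S"
      show "P s \<subseteq> I"
      proof (cases "s \<in> set_option z")
        case False
        then show ?thesis using nz s by (simp add: supp_nz_iff)
      next
        case True
        have "prods (P a) (P b) \<subseteq> I" if "a \<in> supp_nz z" for a b
          using nz[OF that] Iprods by (intro prods_subsetI sI) blast+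
        then show ?thesis unfolding tightD[OF True] by (intro span_minimal sI) blast
      qed
    qed
  qed
  \<comment> \<open>If all products vanished, every element would be central, yet some component is
    nonzero.\<close>
  moreover have "prods UNIV UNIV \<noteq> {0}"
  proof
    assume "prods UNIV UNIV = {0}"
    then have "idealizer {0} = UNIV"
      using br_in_prods[of _ UNIV _ UNIV] mul_in_prods[of _ UNIV _ UNIV] by (auto simp: idealizer_iff)
    then have "(UNIV :: 'b set) = {0}" using idealizer_0_subset_centre centreless by auto
    then show False using index_nonempty component_obtain[of "SOME s. s \<in> S"]
      by (metis UNIV_I singletonD some_in_eq)
  qed
  ultimately show ?thesis by (auto simp: gr_simple_def)
qed

end

theorem theorem6:
  fixes scale :: "'f::field_char_0 \<Rightarrow> 'a::ab_group_add \<Rightarrow> 'a"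
    and br mul :: "'a \<Rightarrow> 'a \<Rightarrow> 'a"
    and S :: "'s set" and P :: "'s \<Rightarrow> 'a set" and z :: "'s option"
  assumes "set_graded_nc_poisson scale br mul S P"
    and "set_graded_nc_poisson.distinguished scale br mul S P z"
    and "nc_poisson_algebra.centre scale br mul = {0}"
    and "set_graded_nc_poisson.multiplicative scale br mul S P"
    and "set_graded_nc_poisson.maximal_length scale S P z"
    and "set_graded_nc_poisson.tight scale br mul S P z"
  shows "set_graded_nc_poisson.gr_simple scale br mul S P \<longleftrightarrow>
    (\<forall>l \<in> set_graded_nc_poisson.supp_nz S P z. \<forall>m \<in> set_graded_nc_poisson.supp_nz S P z.
       set_graded_nc_poisson.connected scale br mul S P z l m)"
proof -
  interpret multiplicative_grading scale br mul S P z
    using assms by (simp add: multiplicative_grading_def multiplicative_grading_axioms_def)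
  show ?thesis
    using connected_if_gr_simple gr_simple_if_connected assms(3,6) by blast
qed

end
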